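(* For every real number $r\in(0,1)$, $$\frac{\pi\sqrt{6+2\sqrt{1-r^2}-3r^2}}{4\sqrt2}\le \varepsilon(r)\le \frac{\pi\sqrt{10-2\sqrt{1-r^2}-5r^2}}{4\sqrt2}.$$
   Context: For $0<r<1$, $\varepsilon(r)$ denotes Legendre's complete elliptic integral of the second kind (with modulus $r$): $$\varepsilon(r)=\int_0^{\pi/2}\sqrt{1-r^2\sin^2 t}\,dt.$$ *)

theory Defs
  imports "HOL-Analysis.Analysis"
begin

(* The argument r is the modulus, not the parameter m = r^2. *)
definition ellE :: "real \<Rightarrow> real" where
  "ellE r = integral {0..pi / 2} (\<lambda>t. sqrt (1 - r\<^sup>2 * (sin t)\<^sup>2))"

end

theory Submission
  imports Defs
begin

text \<open>
  Put \<open>b = sqrt (1 - r\<^sup>2)\<close>. The upper bound is Cauchy--Schwarz, in the form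
  \<open>sqrt x \<le> (x / m + m) / 2\<close> with \<open>m\<^sup>2\<close> the mean of \<open>1 - r\<^sup>2 sin\<^sup>2 t\<close>, followed by
  \<open>0 \<le> (1 - b)\<^sup>2\<close>.

  For the lower bound, let \<open>p = (1 - b) / (2 (1 + b))\<close> and \<open>w = p exp (2 i t)\<close>. The integrand
  equals \<open>(1 + b) / 2 * \<bar>1 + 2 w\<bar>\<close>. Since \<open>1 + w\<close> approximates a square root of \<open>1 + 2 w\<close>,
  the modulus \<open>\<bar>1 + 2 w\<bar>\<close> is bounded below, with little loss, by the real part of
  \<open>(1 + 2 w) * cnj (1 + w) / (1 + w)\<close>, which has an elementary antiderivative and mean
  \<open>1 + p\<^sup>2 \<ge> sqrt (1 + 2 p\<^sup>2)\<close>.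
\<close>

text \<open>The real part of \<open>(1 + 2 w) * cnj (1 + w) / (1 + w)\<close> for
  \<open>w = p exp (i a)\<close>, written through \<open>c = cos a\<close>. The form is split so
  that the fraction is \<open>1 - p\<^sup>2\<close> times the real part of
  \<open>1 / (1 + w)\<close>.\<close>

definition modulus_minorant :: "real \<Rightarrow> real \<Rightarrow> real" where
  "modulus_minorant p c = 2 + p * c - (1 - p\<^sup>2) * (1 + p * c) / (1 + 2 * p * c + p\<^sup>2)"

lemma denominator_pos:
  fixes p c :: real
  assumes "\<bar>p\<bar> < 1" and "\<bar>c\<bar> \<le> 1"
  shows "0 < 1 + p * c" and "0 < 1 + 2 * p * c + p\<^sup>2"
proof -
  have "\<bar>p * c\<bar> \<le> \<bar>p\<bar> * 1"
    unfolding abs_mult using assms by (intro mult_left_mono) auto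
  then have pc: "- \<bar>p\<bar> \<le> p * c"
    by linarith
  then show "0 < 1 + p * c"
    using assms by linarith
  have "0 < (1 - \<bar>p\<bar>)\<^sup>2"
    using assms by simp
  also have "\<dots> = 1 - 2 * \<bar>p\<bar> + p\<^sup>2"
    by (simp add: power2_diff)
  also have "\<dots> \<le> 1 + 2 * p * c + p\<^sup>2"
    using pc by linarith
  finally show "0 < 1 + 2 * p * c + p\<^sup>2" .
qed

text \<open>A real part is at most the modulus: the factor \<open>cnj (1 + w) / (1 + w)\<close> is
  unimodular, and the radicand is the squared modulus of \<open>1 + 2 w\<close>.\<close>

lemma modulus_minorant_le:
  fixes p c :: real
  assumes p: "\<bar>p\<bar> < 1" and c: "\<bar>c\<bar> \<le> 1"
  shows "modulus_minorant p c \<le> sqrt (1 + 4 * p * c + 4 * p\<^sup>2)"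
proof -
  define D where "D = 1 + 2 * p * c + p\<^sup>2"
  define N where "N = (2 + p * c) * D - (1 - p\<^sup>2) * (1 + p * c)"
  have D: "0 < D"
    unfolding D_def using denominator_pos[OF p c] by simp
  have L: "modulus_minorant p c = N / D"
    using D unfolding modulus_minorant_def N_def D_def[symmetric] by (simp add: field_simps)
  have "c\<^sup>2 \<le> 1"
    using c by (simp add: abs_square_le_1)
  then have "0 \<le> 4 * p ^ 4 * (1 - c\<^sup>2) * (c + p)\<^sup>2"
    by simp
  \<comment> \<open>the square of the imaginary part of \<open>(1 + 2 w) * (cnj (1 + w))\<^sup>2\<close>\<close>
  also have "\<dots> = (1 + 4 * p * c + 4 * p\<^sup>2) * D\<^sup>2 - N\<^sup>2"
    unfolding N_def D_def by algebra
  finally have "(N / D)\<^sup>2 \<le> 1 + 4 * p * c + 4 * p\<^sup>2"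
    using D by (simp add: power_divide field_simps)
  then show ?thesis
    unfolding L by (rule real_le_rsqrt)
qed

text \<open>Along \<open>w = p exp (2 i t)\<close>, the argument of \<open>1 + w\<close> has
  derivative \<open>2 Re (w / (1 + w)) = 2 - 2 Re (1 / (1 + w))\<close>, which makes the fraction
  integrable in closed form. The sine and arctangent terms vanish at both endpoints, so only the
  linear terms contribute.\<close>

lemma has_integral_modulus_minorant:
  fixes p :: real
  assumes p: "\<bar>p\<bar> < 1"
  shows "((\<lambda>t. modulus_minorant p (cos (2 * t))) has_integral pi / 2 * (1 + p\<^sup>2)) {0..pi / 2}"
proof -
  \<comment> \<open>the arctangent is the argument of \<open>1 + w\<close>\<close>
  define F where "F = (\<lambda>t. 2 * t + p * sin (2 * t) / 2
    - (1 - p\<^sup>2) * (t - arctan (p * sin (2 * t) / (1 + p * cos (2 * t))) / 2))"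
  have deriv: "(F has_real_derivative modulus_minorant p (cos (2 * t))) (at t)" for t
  proof -
    define c s where "c = cos (2 * t)" and "s = sin (2 * t)"
    have s: "s\<^sup>2 = 1 - c\<^sup>2"
      unfolding c_def s_def by (simp add: sin_squared_eq)
    have P: "0 < 1 + p * c" and D: "0 < 1 + 2 * p * c + p\<^sup>2"
      using denominator_pos[OF p, of c] by (auto simp: c_def)
    define g where "g = (2 * p * c * (1 + p * c) + 2 * p\<^sup>2 * s\<^sup>2) / (1 + p * c)\<^sup>2"
    have quot: "((\<lambda>t. p * sin (2 * t) / (1 + p * cos (2 * t))) has_real_derivative g) (at t)"
      unfolding g_def c_def s_def
      using P[unfolded c_def]
      by (auto intro!: derivative_eq_intros simp: power2_eq_square field_simps)
    define d where "d = g / (1 + (p * s / (1 + p * c))\<^sup>2)"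
    have arctan: "((\<lambda>t. arctan (p * sin (2 * t) / (1 + p * cos (2 * t))))
        has_real_derivative d) (at t)"
      using DERIV_chain2[OF DERIV_arctan quot]
      by (simp add: d_def c_def s_def divide_inverse mult.commute)
    have F': "(F has_real_derivative 2 + p * c - (1 - p\<^sup>2) * (1 - d / 2)) (at t)"
      unfolding F_def c_def
      by (rule arctan derivative_eq_intros refl | simp)+
    have "1 + (p * s / (1 + p * c))\<^sup>2 = ((1 + p * c)\<^sup>2 + p\<^sup>2 * s\<^sup>2) / (1 + p * c)\<^sup>2"
      using P by (simp add: power_divide power_mult_distrib field_simps)
    also have "(1 + p * c)\<^sup>2 + p\<^sup>2 * s\<^sup>2 = 1 + 2 * p * c + p\<^sup>2"
      unfolding s by algebra
    finally have q: "d = (2 * p * c * (1 + p * c) + 2 * p\<^sup>2 * s\<^sup>2) / (1 + 2 * p * c + p\<^sup>2)"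
      unfolding d_def g_def using P by simp
    \<comment> \<open>Both sides are twice the real part of \<open>w * cnj (1 + w)\<close>.\<close>
    have num: "2 * p * c * (1 + p * c) + 2 * p\<^sup>2 * s\<^sup>2
        = 2 * ((1 + 2 * p * c + p\<^sup>2) - (1 + p * c))"
      unfolding s by algebra
    have "1 - d / 2 = (1 + p * c) / (1 + 2 * p * c + p\<^sup>2)"
    proof -
      have "1 - 2 * (y - x) / y / 2 = x / y" if "0 < y" for x y :: real
        using that by (simp add: field_simps)
      then show ?thesis
        unfolding q num using D by blast
    qed
    then show ?thesis
      using F' unfolding modulus_minorant_def c_def[symmetric] by simp
  qed
  have "((\<lambda>t. modulus_minorant p (cos (2 * t))) has_integral F (pi / 2) - F 0) {0..pi / 2}"
    by (rule fundamental_theorem_of_calculus)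
      (auto intro!: has_field_derivative_at_within deriv
        simp flip: has_real_derivative_iff_has_vector_derivative)
  moreover have "F (pi / 2) - F 0 = pi / 2 * (1 + p\<^sup>2)"
    unfolding F_def by (simp add: field_simps)
  ultimately show ?thesis
    by simp
qed

lemma has_integral_one_minus_sin_squared:
  fixes k :: real
  shows "((\<lambda>t. 1 - k * (sin t)\<^sup>2) has_integral pi / 2 * (1 - k / 2)) {0..pi / 2}"
proof -
  define F where "F = (\<lambda>t. t - k * (t / 2 - sin (2 * t) / 4))"
  have "(F has_real_derivative 1 - k * (1 / 2 - cos (2 * t) / 2)) (at t)" for t
    unfolding F_def by (auto intro!: derivative_eq_intros)
  then have deriv: "(F has_real_derivative 1 - k * (sin t)\<^sup>2) (at t)" for t
    by (simp add: cos_double_sin diff_divide_distrib)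
  have "((\<lambda>t. 1 - k * (sin t)\<^sup>2) has_integral F (pi / 2) - F 0) {0..pi / 2}"
    by (rule fundamental_theorem_of_calculus)
      (auto intro!: has_field_derivative_at_within deriv
        simp flip: has_real_derivative_iff_has_vector_derivative)
  moreover have "F (pi / 2) - F 0 = pi / 2 * (1 - k / 2)"
    unfolding F_def by (simp add: field_simps)
  ultimately show ?thesis
    by simp
qed

lemma has_integral_ellE:
  "((\<lambda>t. sqrt (1 - r\<^sup>2 * (sin t)\<^sup>2)) has_integral ellE r) {0..pi / 2}"
  unfolding ellE_def
  by (intro integrable_integral integrable_continuous_real continuous_intros)

lemma ellE_upper:
  fixes r :: real
  assumes "0 < r" and "r < 1"
  shows "ellE r \<le> pi / 2 * sqrt (1 - r\<^sup>2 / 2)"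
proof -
  have r2: "r\<^sup>2 < 1"
    using assms by (simp add: abs_square_less_1)
  \<comment> \<open>\<open>m\<close> is the root mean square of the integrand; with this choice the
    two terms of the majorant have equal integrals.\<close>
  define m where "m = sqrt (1 - r\<^sup>2 / 2)"
  have m: "0 < m" "m\<^sup>2 = 1 - r\<^sup>2 / 2"
    unfolding m_def using r2 by auto
  have "((\<lambda>t. (1 - r\<^sup>2 * (sin t)\<^sup>2) / (2 * m) + m / 2) has_integral
      pi / 2 * (1 - r\<^sup>2 / 2) / (2 * m) + pi / 2 * (m / 2)) {0..pi / 2}"
    using has_integral_add[OF
        has_integral_divide[OF has_integral_one_minus_sin_squared[of "r\<^sup>2"], of "2 * m"]
        has_integral_const_real[of "m / 2" 0 "pi / 2"]]
    by simp
  then have "ellE r \<le> pi / 2 * (1 - r\<^sup>2 / 2) / (2 * m) + pi / 2 * (m / 2)"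
  proof (rule has_integral_le[OF has_integral_ellE])
    fix t :: real
    define x where "x = 1 - r\<^sup>2 * (sin t)\<^sup>2"
    have "(sin t)\<^sup>2 \<le> 1"
      by (simp add: abs_square_le_1)
    then have "r\<^sup>2 * (sin t)\<^sup>2 \<le> 1 * 1"
      using r2 by (intro mult_mono) auto
    then have x: "(sqrt x)\<^sup>2 = x"
      by (simp add: x_def)
    have "0 \<le> (sqrt x - m)\<^sup>2"
      by simp
    then have "sqrt x \<le> x / (2 * m) + m / 2"
      using m(1) x by (simp add: power2_diff field_simps power2_eq_square)
    then show "sqrt (1 - r\<^sup>2 * (sin t)\<^sup>2) \<le> (1 - r\<^sup>2 * (sin t)\<^sup>2) / (2 * m) + m / 2"
      by (simp add: x_def)
  qed
  also have "\<dots> = pi / 2 * m"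
    using m(1) unfolding m(2)[symmetric] by (simp add: power2_eq_square field_simps)
  finally show ?thesis
    by (simp add: m_def)
qed

lemma ellE_lower:
  fixes r :: real
  assumes "0 < r" and "r < 1"
  defines "b \<equiv> sqrt (1 - r\<^sup>2)"
  defines "p \<equiv> (1 - b) / (2 * (1 + b))"
  shows "pi / 2 * ((1 + b) / 2 * (1 + p\<^sup>2)) \<le> ellE r"
proof -
  have r2: "0 < r\<^sup>2" "r\<^sup>2 < 1"
    using assms by (auto simp: abs_square_less_1)
  have b: "0 \<le> b" "b \<le> 1" "b\<^sup>2 = 1 - r\<^sup>2"
    unfolding b_def using r2 by auto
  have p: "\<bar>p\<bar> < 1"
    unfolding p_def using b by (simp add: field_simps)
  have pb: "2 * p * (1 + b) = 1 - b"
    unfolding p_def using b by (simp add: field_simps)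
  have "((\<lambda>t. (1 + b) / 2 * modulus_minorant p (cos (2 * t))) has_integral
      (1 + b) / 2 * (pi / 2 * (1 + p\<^sup>2))) {0..pi / 2}"
    by (intro has_integral_mult_right has_integral_modulus_minorant p)
  then have "(1 + b) / 2 * (pi / 2 * (1 + p\<^sup>2)) \<le> ellE r"
  proof (rule has_integral_le[OF _ has_integral_ellE])
    fix t :: real
    define x where "x = 1 + 4 * p * cos (2 * t) + 4 * p\<^sup>2"
    have "(1 + b) / 2 * modulus_minorant p (cos (2 * t)) \<le> (1 + b) / 2 * sqrt x"
      unfolding x_def using b p by (intro mult_left_mono modulus_minorant_le) auto
    also have "\<dots> = sqrt (((1 + b) / 2)\<^sup>2 * x)"
      using b by (simp add: real_sqrt_mult)
    \<comment> \<open>By the choice of \<open>p\<close>, \<open>(1 + b) / 2 * (1 + 2 w) = ((1 + b) +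
      (1 - b) exp (2 i t)) / 2\<close>, which is \<open>exp (i t) * (cos t - i b sin t)\<close>. Its
      squared modulus is \<open>(cos t)\<^sup>2 + b\<^sup>2 (sin t)\<^sup>2\<close>.\<close>
    also have "((1 + b) / 2)\<^sup>2 * x = 1 - r\<^sup>2 * (sin t)\<^sup>2"
    proof -
      have "4 * (((1 + b) / 2)\<^sup>2 * x) = (1 + b)\<^sup>2 + 2 * (2 * p * (1 + b)) * (1 + b) * cos (2 * t)
          + (2 * p * (1 + b))\<^sup>2"
        unfolding x_def by (simp add: power2_eq_square field_simps)
      also have "\<dots> = 4 * (1 - (1 - b\<^sup>2) * (sin t)\<^sup>2)"
        unfolding pb cos_double_sin by algebra
      finally show ?thesis
        using b by simp
    qed
    finally show "(1 + b) / 2 * modulus_minorant p (cos (2 * t)) \<le> sqrt (1 - r\<^sup>2 * (sin t)\<^sup>2)" .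
  qed
  then show ?thesis
    by (simp add: mult.left_commute)
qed

theorem theorem3p1:
  fixes r :: real
  assumes "0 < r" and "r < 1"
  shows "pi * sqrt (6 + 2 * sqrt (1 - r\<^sup>2) - 3 * r\<^sup>2) / (4 * sqrt 2) \<le> ellE r
    \<and> ellE r \<le> pi * sqrt (10 - 2 * sqrt (1 - r\<^sup>2) - 5 * r\<^sup>2) / (4 * sqrt 2)"
proof
  define b where "b = sqrt (1 - r\<^sup>2)"
  define p where "p = (1 - b) / (2 * (1 + b))"
  have "r\<^sup>2 < 1"
    using assms by (simp add: abs_square_less_1)
  then have b: "0 \<le> b" "r\<^sup>2 = 1 - b\<^sup>2"
    unfolding b_def by auto
  have pb: "2 * p * (1 + b) = 1 - b"
    unfolding p_def using b by (simp add: field_simps)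
  have scale: "pi * sqrt y / (4 * sqrt 2) = pi / 2 * sqrt (y / 8)" for y
    using real_sqrt_mult[of 4 2] by (simp add: real_sqrt_divide)
  \<comment> \<open>In terms of \<open>p\<close>, the claimed lower bound becomes
    \<open>pi / 2 * (1 + b) / 2 * sqrt (1 + 2 * p\<^sup>2)\<close>, so against
    \<open>ellE_lower\<close> only a term \<open>p ^ 4\<close> under the root is given away.\<close>
  have "6 + 2 * b - 3 * r\<^sup>2 = 2 * (1 + b)\<^sup>2 + (2 * p * (1 + b))\<^sup>2"
    unfolding b(2) pb by algebra
  also have "\<dots> = 2 * (1 + b)\<^sup>2 * (1 + 2 * p\<^sup>2)"
    by algebra
  finally have "6 + 2 * b - 3 * r\<^sup>2 = 2 * (1 + b)\<^sup>2 * (1 + 2 * p\<^sup>2)" .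
  moreover have "1 + 2 * p\<^sup>2 \<le> (1 + p\<^sup>2)\<^sup>2"
    by (simp add: power2_sum)
  then have "2 * (1 + b)\<^sup>2 * (1 + 2 * p\<^sup>2) \<le> 2 * (1 + b)\<^sup>2 * (1 + p\<^sup>2)\<^sup>2"
    by (intro mult_left_mono) auto
  ultimately have "(6 + 2 * b - 3 * r\<^sup>2) / 8 \<le> ((1 + b) / 2 * (1 + p\<^sup>2))\<^sup>2"
    by (simp add: power_mult_distrib power_divide)
  then have "sqrt ((6 + 2 * b - 3 * r\<^sup>2) / 8) \<le> (1 + b) / 2 * (1 + p\<^sup>2)"
    using b by (intro real_le_lsqrt) auto
  then have "pi / 2 * sqrt ((6 + 2 * b - 3 * r\<^sup>2) / 8) \<le> pi / 2 * ((1 + b) / 2 * (1 + p\<^sup>2))"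
    by (intro mult_left_mono) auto
  also have "\<dots> \<le> ellE r"
    using ellE_lower[OF assms] unfolding p_def b_def .
  finally show "pi * sqrt (6 + 2 * sqrt (1 - r\<^sup>2) - 3 * r\<^sup>2) / (4 * sqrt 2) \<le> ellE r"
    unfolding scale b_def .
  \<comment> \<open>The radicand of the claimed upper bound exceeds eight times the mean
    \<open>1 - r\<^sup>2 / 2\<close> by exactly this square.\<close>
  have "0 \<le> (1 - b)\<^sup>2"
    by simp
  also have "\<dots> = 10 - 2 * b - 5 * r\<^sup>2 - 8 * (1 - r\<^sup>2 / 2)"
    unfolding b(2) by (simp add: power2_diff field_simps)
  finally have "sqrt (1 - r\<^sup>2 / 2) \<le> sqrt ((10 - 2 * b - 5 * r\<^sup>2) / 8)"
    by (intro real_sqrt_le_mono) simp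
  then have "pi / 2 * sqrt (1 - r\<^sup>2 / 2) \<le> pi / 2 * sqrt ((10 - 2 * b - 5 * r\<^sup>2) / 8)"
    by (intro mult_left_mono) auto
  with ellE_upper[OF assms]
  show "ellE r \<le> pi * sqrt (10 - 2 * sqrt (1 - r\<^sup>2) - 5 * r\<^sup>2) / (4 * sqrt 2)"
    unfolding scale b_def by linarith
qed

end
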